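(* Let $T>0$, let $b:[0,T]\times\mathbb{R}^d\to\mathbb{R}^d$ be measurable, and suppose there are nonnegative $C_0,C_1\in L^1([0,T])$ such that for all $t\in[0,T]$ and $x,y\in\mathbb{R}^d$, $|b(t,x)|\le C_0(t)(1+|x|)$ and $(b(t,x)-b(t,y))\cdot(x-y)\ge -C_1(t)|x-y|^2$. For every $s\in[0,T]$ and almost every $x\in\mathbb{R}^d$, the forward flow $[s,T]\ni t\mapsto\phi_{t,s}(x)$ of $b$ is the unique absolutely continuous solution of $$\partial_t\phi_{t,s}(x)\in\hat b(t,\phi_{t,s}(x))\ \text{ for a.e. }t\in[s,T],\qquad\phi_{s,s}(x)=x,$$ where $\hat b(t,x)$ denotes the convex hull of all limit points of $b(t,y)$ as $y\to x$.
   Context: Backward Filippov flow: for every $(s,x)$ there is a unique absolutely continuous $[0,s]\ni t\mapsto\phi_{t,s}(x)$ with $\partial_t\phi_{t,s}(x)\in\hat b(t,\phi_{t,s}(x))$ for a.e. $t\in[0,s]$ and $\phi_{s,s}(x)=x$; it is Lipschitz in $x$. Forward flow: for $0\le s\le t\le T$ and a.e. $y$, $\phi_{s,t}^{-1}(\{y\})$ is a singleton, whose element is denoted $\phi_{t,s}(y)$; $\phi_{t,s}$ denotes a version of this right inverse that is continuous almost everywhere. The map $(t,x)\mapsto\phi_{t,s}(x)$ is taken in the version for which, for a.e. $x$, $t\mapsto\phi_{t,s}(x)$ is absolutely continuous on $[s,T]$. *)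

theory Defs
  imports "HOL-Analysis.Analysis"
begin

text \<open>The usual \<open>\<epsilon>\<close>-\<open>\<delta>\<close> notion of an absolutely continuous curve on \<open>[u, v]\<close>.  A finite family of
  nonoverlapping closed subintervals is a division (of its own union); a member \<open>K\<close> is the interval
  from \<open>Inf K\<close> to \<open>Sup K\<close>.  (The library constant \<^const>\<open>absolutely_continuous\<close> is about measures.)\<close>

definition abs_continuous_curve :: "real \<Rightarrow> real \<Rightarrow> (real \<Rightarrow> 'a::euclidean_space) \<Rightarrow> bool" where
  "abs_continuous_curve u v X \<longleftrightarrow>
     (\<forall>\<epsilon>>0. \<exists>\<delta>>0. \<forall>D S. D division_of S \<longrightarrow> S \<subseteq> {u..v} \<longrightarrow> (\<Sum>K\<in>D. Sup K - Inf K) < \<delta> \<longrightarrow>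
        (\<Sum>K\<in>D. norm (X (Sup K) - X (Inf K))) < \<epsilon>)"

text \<open>Limits along \<open>y \<rightarrow> x\<close> are punctured: \<^term>\<open>at x\<close> makes \<open>y n \<noteq> x\<close> eventually.  For a field \<open>f\<close>
  satisfying \<open>(f y - f x) \<bullet> (y - x) \<ge> - C * (norm (y - x))\<^sup>2\<close>, admitting \<open>y n = x\<close> as well would not
  change the convex hull: if \<open>f x\<close> were strictly separated from the (compact) hull by a vector \<open>e\<close>,
  approach \<open>x\<close> along \<open>x + r *\<^sub>R e\<close>.\<close>

definition limit_points_at :: "('a::euclidean_space \<Rightarrow> 'a) \<Rightarrow> 'a \<Rightarrow> 'a set" where
  "limit_points_at f x =
     {z. \<exists>y::nat \<Rightarrow> 'a. filterlim y (at x) sequentially \<and> (\<lambda>n. f (y n)) \<longlonglongrightarrow> z}"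

definition filippov_hull :: "(real \<Rightarrow> 'a::euclidean_space \<Rightarrow> 'a) \<Rightarrow> real \<Rightarrow> 'a \<Rightarrow> 'a set" where
  "filippov_hull b t x = convex hull (limit_points_at (b t) x)"

definition filippov_solution ::
    "(real \<Rightarrow> 'a::euclidean_space \<Rightarrow> 'a) \<Rightarrow> real \<Rightarrow> real \<Rightarrow> (real \<Rightarrow> 'a) \<Rightarrow> bool" where
  "filippov_solution b u v X \<longleftrightarrow>
     abs_continuous_curve u v X \<and>
     (AE t in lebesgue_on {u..v}.
        \<exists>w \<in> filippov_hull b t (X t). (X has_vector_derivative w) (at t within {u..v}))"

text \<open>A single family \<open>\<phi>\<close> carries both flows, \<open>\<phi> t s x\<close> being the position at time \<open>t\<close> of the
  trajectory that is at \<open>x\<close> at time \<open>s\<close>: the values with \<open>t \<le> s\<close> form the backward flow, those with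
  \<open>t \<ge> s\<close> the forward flow.  Uniqueness of the backward trajectories and their Lipschitz dependence
  on \<open>x\<close> are consequences of the one-sided Lipschitz bound on \<open>b\<close>, so they are not made part of the
  definition.\<close>

definition backward_flow ::
    "(real \<Rightarrow> 'a::euclidean_space \<Rightarrow> 'a) \<Rightarrow> real \<Rightarrow> (real \<Rightarrow> real \<Rightarrow> 'a \<Rightarrow> 'a) \<Rightarrow> bool" where
  "backward_flow b T \<phi> \<longleftrightarrow>
     (\<forall>s\<in>{0..T}. \<forall>x. filippov_solution b 0 s (\<lambda>t. \<phi> t s x) \<and> \<phi> s s x = x)"

text \<open>The forward flow is obtained from the backward flow alone: it is an almost everywhere defined
  inverse of it, in a version with the stated regularity.  That it solves the
  differential inclusion forward in time is not part of the definition.\<close>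

definition forward_flow ::
    "(real \<Rightarrow> 'a::euclidean_space \<Rightarrow> 'a) \<Rightarrow> real \<Rightarrow> (real \<Rightarrow> real \<Rightarrow> 'a \<Rightarrow> 'a) \<Rightarrow> bool" where
  "forward_flow b T \<phi> \<longleftrightarrow>
     backward_flow b T \<phi> \<and>
     (\<forall>s t. 0 \<le> s \<longrightarrow> s \<le> t \<longrightarrow> t \<le> T \<longrightarrow>
        (AE y in lebesgue. \<phi> s t -` {y} = {\<phi> t s y}) \<and>
        (AE y in lebesgue. isCont (\<phi> t s) y)) \<and>
     (\<forall>s\<in>{0..T}. AE x in lebesgue. abs_continuous_curve s T (\<lambda>t. \<phi> t s x))"

end

theory Submission
  imports Defs
begin

text \<open>
  The one-sided Lipschitz bound passes from \<open>b t\<close> to its Filippov hull, because the inequality survives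
  limits and is affine in each of the two velocities
  (\<open>filippov_hull_one_sided_Lipschitz\<close>).  Hence along two solutions \<open>X\<close>, \<open>Y\<close> the function
  \<open>g = |X - Y|\<^sup>2\<close> satisfies \<open>g' \<ge> - 2 C g\<close> almost everywhere, and a Gronwall argument run
  backwards in time shows that solutions meeting at some time agree before it
  (\<open>filippov_solution_backward_unique\<close>).  The differential inequality holds only almost everywhere, so
  it has to be integrated by the fundamental theorem of calculus for absolutely continuous functions
  (\<open>fundamental_theorem_of_calculus_abs_continuous\<close>).

  Backward uniqueness means that the backward flow retraces every solution: if \<open>X\<close> is a solution on
  \<open>[s, t]\<close>, then \<open>\<phi> s t (X t) = X s\<close> (\<open>backward_flow_follows_solution\<close>).  So any solution \<open>X\<close> on
  \<open>[s, T]\<close> starting at \<open>x\<close> has \<open>X t\<close> in the fibre of \<open>\<phi> s t\<close> over \<open>x\<close>.  For almost every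
  \<open>x\<close> this fibre is \<open>{\<phi> t s x}\<close> simultaneously for all rational \<open>t\<close> and for \<open>t = T\<close>, and \<open>\<phi> t s x\<close>
  is continuous in \<open>t\<close>; therefore \<open>X t = \<phi> t s x\<close> for all \<open>t\<close>.  This is uniqueness.  Existence is the
  same statement applied to the backward trajectory that ends at the point \<open>\<phi> T s x\<close> at time \<open>T\<close>: it is a
  solution, and it passes through \<open>x\<close> at time \<open>s\<close> because \<open>\<phi> T s x\<close> lies in the fibre of \<open>\<phi> s T\<close>
  over \<open>x\<close>.
\<close>

section \<open>Absolutely continuous curves\<close>

lemma division_member_Inf_Sup:
  fixes S :: "real set"
  assumes "D division_of S" "K \<in> D"
  shows "K = {Inf K..Sup K}" "Inf K \<le> Sup K" "Inf K \<in> S" "Sup K \<in> S"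
proof -
  obtain p q where K: "K = cbox p q" and "K \<noteq> {}" and "K \<subseteq> S"
    using division_ofD(2-4)[OF assms] by metis
  then have "p \<le> q" by simp
  then show "K = {Inf K..Sup K}" "Inf K \<le> Sup K" using K by auto
  show "Inf K \<in> S" "Sup K \<in> S" using K \<open>p \<le> q\<close> \<open>K \<subseteq> S\<close> by auto
qed

lemma abs_continuous_curve_subset:
  assumes "abs_continuous_curve u v X" "{u'..v'} \<subseteq> {u..v}"
  shows "abs_continuous_curve u' v' X"
  using assms unfolding abs_continuous_curve_def by (meson order_trans)

lemma abs_continuous_curve_cong:
  assumes "\<And>t. t \<in> {u..v} \<Longrightarrow> X t = Y t"
  shows "abs_continuous_curve u v X \<longleftrightarrow> abs_continuous_curve u v Y"
proof -
  have "(\<Sum>K\<in>D. norm (X (Sup K) - X (Inf K))) = (\<Sum>K\<in>D. norm (Y (Sup K) - Y (Inf K)))"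
    if "D division_of S" "S \<subseteq> {u..v}" for D S
    by (intro sum.cong refl) (use assms division_member_Inf_Sup[OF that(1)] that(2) in \<open>simp add: subset_iff\<close>)
  then show ?thesis unfolding abs_continuous_curve_def by (metis (no_types, lifting))
qed

lemma abs_continuous_curve_imp_continuous_on:
  assumes X: "abs_continuous_curve u v X"
  shows "continuous_on {u..v} X"
proof (rule uniformly_continuous_imp_continuous, unfold uniformly_continuous_on_def, intro allI impI)
  fix e :: real assume "e > 0"
  then obtain d where "d > 0" and d: "\<And>D S. D division_of S \<Longrightarrow> S \<subseteq> {u..v} \<Longrightarrow>
      (\<Sum>K\<in>D. Sup K - Inf K) < d \<Longrightarrow> (\<Sum>K\<in>D. norm (X (Sup K) - X (Inf K))) < e"
    using X unfolding abs_continuous_curve_def by metis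
  have small: "norm (X t - X s) < e" if "s \<in> {u..v}" "t \<in> {u..v}" "s \<le> t" "t - s < d" for s t
    using d[of "{{s..t}}" "{s..t}"] division_of_self[of s t] that by auto
  have "dist (X t) (X s) < e" if "s \<in> {u..v}" "t \<in> {u..v}" "dist t s < d" for s t
    using small[of s t] small[of t s] that
    by (cases "s \<le> t") (auto simp: dist_norm norm_minus_commute)
  then show "\<exists>d>0. \<forall>x\<in>{u..v}. \<forall>x'\<in>{u..v}. dist x' x < d \<longrightarrow> dist (X x') (X x) < e"
    using \<open>d > 0\<close> by blast
qed

lemma abs_continuous_curve_diff:
  assumes X: "abs_continuous_curve u v X" and Y: "abs_continuous_curve u v Y"
  shows "abs_continuous_curve u v (\<lambda>t. X t - Y t)"
  unfolding abs_continuous_curve_def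
proof (intro allI impI)
  fix e :: real assume "e > 0"
  then have "e/2 > 0" by simp
  obtain d1 where "d1 > 0" and d1: "\<And>D S. D division_of S \<Longrightarrow> S \<subseteq> {u..v} \<Longrightarrow>
      (\<Sum>K\<in>D. Sup K - Inf K) < d1 \<Longrightarrow> (\<Sum>K\<in>D. norm (X (Sup K) - X (Inf K))) < e/2"
    using X \<open>e/2 > 0\<close> unfolding abs_continuous_curve_def by metis
  obtain d2 where "d2 > 0" and d2: "\<And>D S. D division_of S \<Longrightarrow> S \<subseteq> {u..v} \<Longrightarrow>
      (\<Sum>K\<in>D. Sup K - Inf K) < d2 \<Longrightarrow> (\<Sum>K\<in>D. norm (Y (Sup K) - Y (Inf K))) < e/2"
    using Y \<open>e/2 > 0\<close> unfolding abs_continuous_curve_def by metis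
  have "(\<Sum>K\<in>D. norm (X (Sup K) - Y (Sup K) - (X (Inf K) - Y (Inf K)))) < e"
    if DS: "D division_of S" "S \<subseteq> {u..v}" "(\<Sum>K\<in>D. Sup K - Inf K) < min d1 d2" for D S
  proof -
    have "(\<Sum>K\<in>D. norm (X (Sup K) - Y (Sup K) - (X (Inf K) - Y (Inf K))))
        \<le> (\<Sum>K\<in>D. norm (X (Sup K) - X (Inf K)) + norm (Y (Sup K) - Y (Inf K)))"
    proof (rule sum_mono)
      fix K
      have "X (Sup K) - Y (Sup K) - (X (Inf K) - Y (Inf K)) = (X (Sup K) - X (Inf K)) - (Y (Sup K) - Y (Inf K))"
        by simp
      then show "norm (X (Sup K) - Y (Sup K) - (X (Inf K) - Y (Inf K)))
          \<le> norm (X (Sup K) - X (Inf K)) + norm (Y (Sup K) - Y (Inf K))"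
        using norm_triangle_ineq4 by metis
    qed
    also have "\<dots> < e" using d1[OF DS(1,2)] d2[OF DS(1,2)] DS(3) by (simp add: sum.distrib)
    finally show ?thesis .
  qed
  then show "\<exists>\<delta>>0. \<forall>D S. D division_of S \<longrightarrow> S \<subseteq> {u..v} \<longrightarrow> (\<Sum>K\<in>D. Sup K - Inf K) < \<delta> \<longrightarrow>
      (\<Sum>K\<in>D. norm (X (Sup K) - Y (Sup K) - (X (Inf K) - Y (Inf K)))) < e"
    using \<open>d1 > 0\<close> \<open>d2 > 0\<close> by (intro exI[of _ "min d1 d2"]) auto
qed

text \<open>The curve is bounded, and squaring the norm is Lipschitz on bounded sets.\<close>

lemma abs_continuous_curve_norm_square:
  assumes X: "abs_continuous_curve u v X"
  shows "abs_continuous_curve u v (\<lambda>t. (norm (X t))\<^sup>2)"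
  unfolding abs_continuous_curve_def
proof (intro allI impI)
  fix e :: real assume "e > 0"
  have "bounded (X ` {u..v})"
    using abs_continuous_curve_imp_continuous_on[OF X]
    by (intro compact_imp_bounded compact_continuous_image) auto
  then obtain B where "B > 0" and B: "\<And>t. t \<in> {u..v} \<Longrightarrow> norm (X t) \<le> B"
    by (auto simp: bounded_pos)
  then have "e / (2*B) > 0" using \<open>e > 0\<close> by simp
  then obtain d where "d > 0" and d: "\<And>D S. D division_of S \<Longrightarrow> S \<subseteq> {u..v} \<Longrightarrow>
      (\<Sum>K\<in>D. Sup K - Inf K) < d \<Longrightarrow> (\<Sum>K\<in>D. norm (X (Sup K) - X (Inf K))) < e / (2*B)"
    using X unfolding abs_continuous_curve_def by metis
  have lip: "norm ((norm (X t))\<^sup>2 - (norm (X s))\<^sup>2) \<le> 2*B * norm (X t - X s)"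
    if "s \<in> {u..v}" "t \<in> {u..v}" for s t
  proof -
    have "(norm (X t))\<^sup>2 - (norm (X s))\<^sup>2 = (norm (X t) + norm (X s)) * (norm (X t) - norm (X s))"
      by (simp add: power2_eq_square algebra_simps)
    also have "norm \<dots> \<le> (2*B) * norm (X t - X s)"
      unfolding norm_mult
      by (intro mult_mono) (use B[OF that(1)] B[OF that(2)] \<open>B > 0\<close> in \<open>auto intro: norm_triangle_ineq3\<close>)
    finally show ?thesis .
  qed
  have "(\<Sum>K\<in>D. norm ((norm (X (Sup K)))\<^sup>2 - (norm (X (Inf K)))\<^sup>2)) < e"
    if DS: "D division_of S" "S \<subseteq> {u..v}" "(\<Sum>K\<in>D. Sup K - Inf K) < d" for D S
  proof -
    have "(\<Sum>K\<in>D. norm ((norm (X (Sup K)))\<^sup>2 - (norm (X (Inf K)))\<^sup>2))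
        \<le> (\<Sum>K\<in>D. 2*B * norm (X (Sup K) - X (Inf K)))"
      using division_member_Inf_Sup(3,4)[OF DS(1)] DS(2) by (intro sum_mono lip) blast+
    also have "\<dots> < e" using d[OF DS] \<open>B > 0\<close> by (simp add: field_simps flip: sum_distrib_left)
    finally show ?thesis .
  qed
  then show "\<exists>\<delta>>0. \<forall>D S. D division_of S \<longrightarrow> S \<subseteq> {u..v} \<longrightarrow> (\<Sum>K\<in>D. Sup K - Inf K) < \<delta> \<longrightarrow>
      (\<Sum>K\<in>D. norm ((norm (X (Sup K)))\<^sup>2 - (norm (X (Inf K)))\<^sup>2)) < e"
    using \<open>d > 0\<close> by blast
qed

text \<open>The straddle estimate: the difference quotient over an interval that contains the point \<open>x\<close>, not
  necessarily as an endpoint, is controlled because the errors at the two ends add up to the length of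
  the interval.  The tag of an interval in a division may be such an interior point.\<close>

lemma has_vector_derivative_straddle:
  fixes f :: "real \<Rightarrow> 'a::real_normed_vector"
  assumes "(f has_vector_derivative f') (at x within S)" "e > 0"
  obtains d where "d > 0"
    "\<And>p q. \<lbrakk>p \<in> S; q \<in> S; p \<le> x; x \<le> q; {p..q} \<subseteq> ball x d\<rbrakk>
       \<Longrightarrow> norm ((q - p) *\<^sub>R f' - (f q - f p)) \<le> e * (q - p)"
proof -
  obtain d where "d > 0" and
    d: "\<And>y. y \<in> S \<Longrightarrow> norm (y - x) < d \<Longrightarrow> norm (f y - f x - (y - x) *\<^sub>R f') \<le> e * norm (y - x)"
    using assms unfolding has_vector_derivative_def has_derivative_within_alt by metis
  show ?thesis
  proof (rule that[OF \<open>d > 0\<close>])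
    fix p q assume pq: "p \<in> S" "q \<in> S" "p \<le> x" "x \<le> q" "{p..q} \<subseteq> ball x d"
    then have "p \<in> {p..q}" "q \<in> {p..q}" by auto
    with pq(5) have "p \<in> ball x d" "q \<in> ball x d" by blast+
    then have "norm (p - x) < d" "norm (q - x) < d" by (auto simp: dist_real_def)
    then have *: "norm (f p - f x - (p - x) *\<^sub>R f') \<le> e * (x - p)"
         "norm (f q - f x - (q - x) *\<^sub>R f') \<le> e * (q - x)"
      using d[of p] d[of q] pq by auto
    have eq: "(q - p) *\<^sub>R f' - (f q - f p)
        = (f p - f x - (p - x) *\<^sub>R f') - (f q - f x - (q - x) *\<^sub>R f')"
      by (simp add: algebra_simps)
    have "norm ((q - p) *\<^sub>R f' - (f q - f p)) \<le> e * (x - p) + e * (q - x)"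
      unfolding eq by (rule order_trans[OF norm_triangle_ineq4 add_mono[OF *]])
    then show "norm ((q - p) *\<^sub>R f' - (f q - f p)) \<le> e * (q - p)" by (simp add: algebra_simps)
  qed
qed

text \<open>This is where absolute continuity is spent: tags in a null set are confined to an open set of small
  measure, so the intervals carrying them have small total length, and the curve moves little over
  them.\<close>

lemma abs_continuous_curve_null_tags_small:
  fixes f :: "real \<Rightarrow> 'a::euclidean_space"
  assumes f: "abs_continuous_curve a b f" and N: "negligible N" and "e > 0"
  obtains U where "open U" "N \<subseteq> U"
    "\<And>p. p tagged_partial_division_of {a..b} \<Longrightarrow> (\<And>x K. (x, K) \<in> p \<Longrightarrow> K \<subseteq> U) \<Longrightarrow>
       (\<Sum>(x, K)\<in>p. norm (f (Sup K) - f (Inf K))) < e"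
proof -
  obtain d where "d > 0" and d: "\<And>D S. D division_of S \<Longrightarrow> S \<subseteq> {a..b} \<Longrightarrow>
      (\<Sum>K\<in>D. Sup K - Inf K) < d \<Longrightarrow> (\<Sum>K\<in>D. norm (f (Sup K) - f (Inf K))) < e"
    using f \<open>e > 0\<close> unfolding abs_continuous_curve_def by metis
  have Nm: "N \<in> null_sets lebesgue" using N by (simp add: negligible_iff_null_sets)
  then have "N \<in> sets lebesgue" by blast
  then obtain U where U: "open U" "N \<subseteq> U" "U - N \<in> lmeasurable" "emeasure lebesgue (U - N) < ennreal d"
    using sets_lebesgue_outer_open \<open>d > 0\<close> by metis
  have Usets: "U \<in> sets lebesgue" using \<open>open U\<close> by auto
  have "emeasure lebesgue U < ennreal d" using U(4) Nm Usets by (simp add: emeasure_Diff_null_set)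
  then have Ul: "U \<in> lmeasurable"
    using Usets by (auto simp: fmeasurable_def top.not_eq_extremum intro: less_trans)
  then have Um: "measure lebesgue U < d"
    using \<open>emeasure lebesgue U < ennreal d\<close> \<open>d > 0\<close> by (simp add: emeasure_eq_measure2 ennreal_less_iff)
  show ?thesis
  proof (rule that[OF U(1,2)])
    fix p assume p: "p tagged_partial_division_of {a..b}" and pU: "\<And>x K. (x, K) \<in> p \<Longrightarrow> K \<subseteq> U"
    let ?S = "\<Union>(snd ` p)"
    have D: "snd ` p division_of ?S" by (rule partial_division_of_tagged_division[OF p])
    have S: "?S \<subseteq> {a..b}" "?S \<subseteq> U" using tagged_partial_division_ofD(3)[OF p] pU by force+
    have "(\<Sum>K\<in>snd ` p. Sup K - Inf K) = (\<Sum>K\<in>snd ` p. measure lebesgue K)"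
    proof (intro sum.cong refl)
      fix K assume "K \<in> snd ` p"
      then obtain k l where "K = cbox k l" "K \<noteq> {}" by (metis D division_ofD(3,4))
      then show "Sup K - Inf K = measure lebesgue K" by simp
    qed
    also have "\<dots> = measure lebesgue ?S" by (rule content_division[OF D])
    also have "\<dots> \<le> measure lebesgue U"
      using S Ul lmeasurable_division[OF D] by (intro measure_mono_fmeasurable) auto
    also have "\<dots> < d" by (rule Um)
    finally have lt: "(\<Sum>K\<in>snd ` p. norm (f (Sup K) - f (Inf K))) < e" by (rule d[OF D S(1)])
    (* The library lemma that passes from tagged intervals to intervals asks for the value 0 on the
       empty set, where Sup and Inf are unspecified; hence the case distinction. *)
    let ?F = "\<lambda>K. if K = {} then 0 else norm (f (Sup K) - f (Inf K))"
    have "p tagged_division_of ?S"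
      unfolding tagged_division_of_def
    proof
      show "p tagged_partial_division_of ?S"
        using p unfolding tagged_partial_division_of_def by force
    qed force
    then have "(\<Sum>(x, K)\<in>p. ?F K) = (\<Sum>K\<in>snd ` p. ?F K)"
    proof (rule sum.over_tagged_division_lemma)
      fix k l :: real assume "box k l = {}"
      then have "l \<le> k" by (simp add: box_real)
      then show "?F (cbox k l) = 0" by (cases "k = l") auto
    qed
    moreover have "(\<Sum>(x, K)\<in>p. ?F K) = (\<Sum>(x, K)\<in>p. norm (f (Sup K) - f (Inf K)))"
      using tagged_partial_division_ofD(2)[OF p] by (intro sum.cong refl) fastforce
    moreover have "(\<Sum>K\<in>snd ` p. ?F K) = (\<Sum>K\<in>snd ` p. norm (f (Sup K) - f (Inf K)))"
      using division_ofD(3)[OF D] by (intro sum.cong refl) auto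
    ultimately show "(\<Sum>(x, K)\<in>p. norm (f (Sup K) - f (Inf K))) < e" using lt by simp
  qed
qed

text \<open>For a tagged division fine enough, the increments over intervals with a tag outside \<open>N\<close> are close
  to the terms of the Riemann sum by the straddle estimate; those over intervals with a tag in \<open>N\<close>
  add up to little by absolute continuity, and the integrand may be taken to vanish there.\<close>

theorem fundamental_theorem_of_calculus_abs_continuous:
  fixes f :: "real \<Rightarrow> 'a::euclidean_space"
  assumes "a \<le> b" and f: "abs_continuous_curve a b f" and N: "negligible N"
    and f': "\<And>t. t \<in> {a..b} - N \<Longrightarrow> (f has_vector_derivative f' t) (at t within {a..b})"
  shows "(f' has_integral f b - f a) {a..b}"
proof -
  let ?g = "\<lambda>t. if t \<in> N then 0 else f' t"
  have "(?g has_integral f b - f a) {a..b}"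
    unfolding has_integral_real
  proof (intro allI impI)
    fix e :: real assume "e > 0"
    (* The +1 keeps the constant finite for a = b and makes the error below strict. *)
    define c where "c = e / (2 * (b - a + 1))"
    have c: "c > 0" "c * (b - a) < e/2"
      using \<open>e > 0\<close> \<open>a \<le> b\<close> by (auto simp: c_def field_simps)
    obtain U where U: "open U" "N \<subseteq> U" and small:
      "\<And>p. p tagged_partial_division_of {a..b} \<Longrightarrow> (\<And>x K. (x, K) \<in> p \<Longrightarrow> K \<subseteq> U) \<Longrightarrow>
         (\<Sum>(x, K)\<in>p. norm (f (Sup K) - f (Inf K))) < e/2"
      using abs_continuous_curve_null_tags_small[OF f N, of "e/2"] \<open>e > 0\<close> by auto
    have "\<forall>x. \<exists>d>0. x \<in> {a..b} - N \<longrightarrow> (\<forall>p q. p \<in> {a..b} \<longrightarrow> q \<in> {a..b} \<longrightarrow> p \<le> x \<longrightarrow> x \<le> q \<longrightarrow>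
        {p..q} \<subseteq> ball x d \<longrightarrow> norm ((q - p) *\<^sub>R f' x - (f q - f p)) \<le> c * (q - p))"
    proof
      fix x
      show "\<exists>d>0. x \<in> {a..b} - N \<longrightarrow> (\<forall>p q. p \<in> {a..b} \<longrightarrow> q \<in> {a..b} \<longrightarrow> p \<le> x \<longrightarrow> x \<le> q \<longrightarrow>
        {p..q} \<subseteq> ball x d \<longrightarrow> norm ((q - p) *\<^sub>R f' x - (f q - f p)) \<le> c * (q - p))"
      proof (cases "x \<in> {a..b} - N")
        case True
        from has_vector_derivative_straddle[OF f'[OF True] c(1)] show ?thesis by metis
      qed (auto intro: exI[of _ 1])
    qed
    then obtain d where d0: "\<And>x. d x > 0" and
      d: "\<And>x p q. \<lbrakk>x \<in> {a..b} - N; p \<in> {a..b}; q \<in> {a..b}; p \<le> x; x \<le> q; {p..q} \<subseteq> ball x (d x)\<rbrakk>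
         \<Longrightarrow> norm ((q - p) *\<^sub>R f' x - (f q - f p)) \<le> c * (q - p)"
      by metis
    define \<gamma> where "\<gamma> x = (if x \<in> N then U else ball x (d x))" for x
    have gauge: "gauge \<gamma>" using U d0 by (auto simp: gauge_def \<gamma>_def)
    have close: "norm ((\<Sum>(x, K)\<in>p. measure lborel K *\<^sub>R ?g x) - (f b - f a)) < e"
      if p: "p tagged_division_of {a..b}" and fine: "\<gamma> fine p" for p
    proof -
      define p1 where "p1 = {z \<in> p. fst z \<in> N}"
      define p2 where "p2 = p - p1"
      have p12: "p = p1 \<union> p2" "p1 \<inter> p2 = {}" and fin: "finite p1" "finite p2"
        using tagged_division_ofD(1)[OF p] by (auto simp: p1_def p2_def)
      let ?F = "\<lambda>(x, K). measure lborel K *\<^sub>R ?g x - (f (Sup K) - f (Inf K))"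
      have ba: "b - a = (\<Sum>(x, K)\<in>p. Sup K - Inf K)" "f b - f a = (\<Sum>(x, K)\<in>p. f (Sup K) - f (Inf K))"
        using additive_tagged_division_1[OF \<open>a \<le> b\<close> p, of "\<lambda>x. x"]
          additive_tagged_division_1[OF \<open>a \<le> b\<close> p, of f] by auto
      have mem: "K = {Inf K..Sup K} \<and> Inf K \<in> {a..b} \<and> Sup K \<in> {a..b} \<and> Inf K \<le> x \<and> x \<le> Sup K \<and>
          measure lborel K = Sup K - Inf K" if xK: "(x, K) \<in> p" for x K
      proof -
        have "K \<in> snd ` p" using xK by force
        note * = division_member_Inf_Sup[OF division_of_tagged_division[OF p] this]
        moreover have "x \<in> K" using p xK by blast
        moreover have "measure lborel {Inf K..Sup K} = Sup K - Inf K" using *(2) by simp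
        ultimately show ?thesis by (metis atLeastAtMost_iff)
      qed
      have "(\<Sum>z\<in>p1. norm (?F z)) = (\<Sum>(x, K)\<in>p1. norm (f (Sup K) - f (Inf K)))"
        by (intro sum.cong refl) (auto simp: p1_def norm_minus_commute)
      also have "\<dots> < e/2"
      proof (rule small)
        show "p1 tagged_partial_division_of {a..b}"
          using p unfolding tagged_division_of_def
          by (auto simp: p1_def intro: tagged_partial_division_subset)
        show "K \<subseteq> U" if "(x, K) \<in> p1" for x K
          using that fine by (force simp: p1_def \<gamma>_def fine_def)
      qed
      finally have s1: "(\<Sum>z\<in>p1. norm (?F z)) < e/2" .
      have "(\<Sum>z\<in>p2. norm (?F z)) \<le> (\<Sum>(x, K)\<in>p2. c * (Sup K - Inf K))"
      proof (rule sum_mono, clarify)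
        fix x K assume "(x, K) \<in> p2"
        then have xK: "(x, K) \<in> p" "x \<notin> N" by (auto simp: p1_def p2_def)
        have "K \<subseteq> ball x (d x)" using fine xK by (force simp: \<gamma>_def fine_def)
        moreover have "x \<in> {a..b}" using mem[OF xK(1)] by auto
        ultimately show "norm (measure lborel K *\<^sub>R ?g x - (f (Sup K) - f (Inf K))) \<le> c * (Sup K - Inf K)"
          using d[of x "Inf K" "Sup K"] mem[OF xK(1)] xK(2) by auto
      qed
      also have "\<dots> \<le> (\<Sum>(x, K)\<in>p. c * (Sup K - Inf K))"
        using mem c(1) tagged_division_ofD(1)[OF p] by (intro sum_mono2) (force simp: p2_def)+
      also have "\<dots> = c * (b - a)" by (simp add: ba(1) sum_distrib_left split_def)
      finally have s2: "(\<Sum>z\<in>p2. norm (?F z)) \<le> c * (b - a)" .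
      have "(\<Sum>(x, K)\<in>p. measure lborel K *\<^sub>R ?g x) - (f b - f a) = (\<Sum>z\<in>p. ?F z)"
        by (simp add: ba(2) sum_subtractf[symmetric] split_def)
      also have "norm \<dots> \<le> (\<Sum>z\<in>p. norm (?F z))" by (rule norm_sum)
      also have "\<dots> = (\<Sum>z\<in>p1. norm (?F z)) + (\<Sum>z\<in>p2. norm (?F z))"
        unfolding p12(1) by (rule sum.union_disjoint[OF fin p12(2)])
      also have "\<dots> < e" using s1 s2 c(2) by linarith
      finally show ?thesis .
    qed
    show "\<exists>\<gamma>. gauge \<gamma> \<and> (\<forall>p. p tagged_division_of {a..b} \<and> \<gamma> fine p \<longrightarrow>
        norm ((\<Sum>(x, K)\<in>p. measure lborel K *\<^sub>R ?g x) - (f b - f a)) < e)"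
      by (intro exI[of _ \<gamma>] conjI allI impI gauge close) (erule conjunct1 conjunct2)+
  qed
  then show ?thesis by (rule has_integral_spike[OF N, rotated]) auto
qed

lemma abs_continuous_increment_ge_integral:
  fixes f h :: "real \<Rightarrow> real"
  assumes "a \<le> b" "abs_continuous_curve a b f" and N: "negligible N"
    and der: "\<And>t. t \<in> {a..b} - N \<Longrightarrow>
       \<exists>d. (f has_vector_derivative d) (at t within {a..b}) \<and> h t \<le> d"
    and h: "h integrable_on {a..b}"
  shows "integral {a..b} h \<le> f b - f a"
proof -
  obtain d where d: "\<And>t. t \<in> {a..b} - N \<Longrightarrow> (f has_vector_derivative d t) (at t within {a..b})"
    "\<And>t. t \<in> {a..b} - N \<Longrightarrow> h t \<le> d t"
    using der by metis
  have "(d has_integral f b - f a) {a..b}"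
    by (rule fundamental_theorem_of_calculus_abs_continuous[OF assms(1,2) N d(1)])
  then have "((\<lambda>t. if t \<in> N then h t else d t) has_integral f b - f a) {a..b}"
    by (rule has_integral_spike[OF N, rotated]) auto
  from has_integral_le[OF integrable_integral[OF h] this] d(2) show ?thesis by auto
qed

section \<open>Backward uniqueness\<close>

text \<open>Suppose \<open>g a > 0\<close> and let \<open>z\<close> be the first zero of \<open>g\<close>.  Shortly before \<open>z\<close> the integral of \<open>c\<close>
  is below \<open>1/2\<close>, so the maximum of \<open>g\<close> there would be at most half of itself.  This route uses only
  continuity of the indefinite integral of \<open>c\<close>, not its differentiability almost everywhere, which an
  integrating factor \<open>exp (\<integral> c)\<close> would require.\<close>

lemma gronwall_backward_zero:
  fixes g c :: "real \<Rightarrow> real"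
  assumes "a \<le> b" and g: "abs_continuous_curve a b g" and N: "negligible N"
    and c: "c absolutely_integrable_on {a..b}" and c0: "\<And>t. t \<in> {a..b} \<Longrightarrow> 0 \<le> c t"
    and der: "\<And>t. t \<in> {a..b} - N \<Longrightarrow>
       \<exists>d. (g has_vector_derivative d) (at t within {a..b}) \<and> - (c t * g t) \<le> d"
    and g0: "\<And>t. t \<in> {a..b} \<Longrightarrow> 0 \<le> g t" and gb: "g b = 0"
  shows "g a = 0"
proof (rule ccontr)
  assume "g a \<noteq> 0"
  have cont: "continuous_on {a..b} g" by (rule abs_continuous_curve_imp_continuous_on[OF g])
  have cg: "(\<lambda>t. c t * g t) absolutely_integrable_on {a..b}"
  proof -
    have "(\<lambda>t. g t * c t) absolutely_integrable_on {a..b}"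
      using cont c
      by (intro absolutely_integrable_bounded_measurable_product_real compact_imp_bounded
          compact_continuous_image continuous_imp_measurable_on_sets_lebesgue) auto
    then show ?thesis by (simp add: mult.commute)
  qed
  have inc: "g r \<le> g q + integral {r..q} (\<lambda>t. c t * g t)" if "a \<le> r" "r \<le> q" "q \<le> b" for r q
  proof -
    have sub: "{r..q} \<subseteq> {a..b}" using that by auto
    have "(\<lambda>t. c t * g t) integrable_on {r..q}"
      by (rule integrable_on_subinterval[OF set_lebesgue_integral_eq_integral(1)[OF cg] sub])
    moreover have "integral {r..q} (\<lambda>t. - (c t * g t)) \<le> g q - g r"
    proof (rule abs_continuous_increment_ge_integral[OF _ _ N])
      show "abs_continuous_curve r q g" by (rule abs_continuous_curve_subset[OF g sub])
      show "\<exists>d. (g has_vector_derivative d) (at t within {r..q}) \<and> - (c t * g t) \<le> d"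
        if "t \<in> {r..q} - N" for t
        using der[of t] that sub by (blast intro: has_vector_derivative_within_subset)
    qed (use that calculation in \<open>auto intro: integrable_neg\<close>)
    ultimately show ?thesis by simp
  qed
  define Z where "Z = {t \<in> {a..b}. g t = 0}"
  have "closed Z"
    using continuous_closed_preimage_constant[OF cont, of 0] by (simp add: Z_def)
  moreover have "b \<in> Z" using gb \<open>a \<le> b\<close> by (simp add: Z_def)
  moreover have bdd: "bdd_below Z" by (auto simp: Z_def intro: bdd_belowI[of _ a])
  ultimately have zZ: "Inf Z \<in> Z" by (intro closed_contains_Inf) auto
  define z where "z = Inf Z"
  have z: "a \<le> z" "z \<le> b" "g z = 0" using zZ by (auto simp: Z_def z_def)
  with \<open>g a \<noteq> 0\<close> have "a < z" by (cases "a = z") auto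
  have pos: "g t > 0" if "a \<le> t" "t < z" for t
  proof -
    have "t \<notin> Z" using cInf_lower[OF _ bdd, of t] that by (force simp: z_def)
    then show ?thesis using g0[of t] that z by (auto simp: Z_def order.strict_iff_order)
  qed
  have ci: "c integrable_on {p..q}" if "a \<le> p" "q \<le> b" for p q
    by (rule integrable_on_subinterval[OF set_lebesgue_integral_eq_integral(1)[OF c]]) (use that in auto)
  have "continuous_on {a..z} (\<lambda>x. integral {x..z} c)"
    using z by (intro indefinite_integral_continuous_1' ci) auto
  then have "((\<lambda>x. integral {x..z} c) \<longlongrightarrow> integral {z..z} c) (at z within {a..z})"
    using z unfolding continuous_on_def by (meson atLeastAtMost_iff order_refl)
  then have "eventually (\<lambda>x. integral {x..z} c < 1/2) (at z within {a..z})"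
    by (rule order_tendstoD) simp
  then obtain \<delta> where "\<delta> > 0" and \<delta>: "\<And>x. x \<in> {a..z} \<Longrightarrow> x \<noteq> z \<Longrightarrow> dist x z < \<delta> \<Longrightarrow> integral {x..z} c < 1/2"
    by (auto simp: eventually_at)
  define r where "r = max a (z - \<delta>/2)"
  have r: "a \<le> r" "r < z" using \<open>a < z\<close> \<open>\<delta> > 0\<close> by (auto simp: r_def)
  have rc: "integral {r..z} c < 1/2"
    using \<open>a < z\<close> \<open>\<delta> > 0\<close> by (intro \<delta>) (auto simp: r_def dist_real_def)
  have "continuous_on {r..z} g" by (rule continuous_on_subset[OF cont]) (use r z in auto)
  then obtain m where m: "m \<in> {r..z}" and max: "\<And>t. t \<in> {r..z} \<Longrightarrow> g t \<le> g m"
    using continuous_attains_sup[of "{r..z}" g] r by auto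
  have "g m > 0" using max[of r] pos[of r] r by auto
  have "g m \<le> g z + integral {m..z} (\<lambda>t. c t * g t)" using m r z by (intro inc) auto
  also have "\<dots> \<le> integral {m..z} (\<lambda>t. c t * g m)"
  proof -
    have "(\<lambda>t. c t * g t) integrable_on {m..z}"
      by (rule integrable_on_subinterval[OF set_lebesgue_integral_eq_integral(1)[OF cg]]) (use m r z in auto)
    moreover have "(\<lambda>t. c t * g m) integrable_on {m..z}"
      using m r z by (intro integrable_on_mult_left ci) auto
    ultimately have "integral {m..z} (\<lambda>t. c t * g t) \<le> integral {m..z} (\<lambda>t. c t * g m)"
      by (rule integral_le) (use m r z max c0 in \<open>auto intro!: mult_left_mono\<close>)
    then show ?thesis using z by simp
  qed
  also have "\<dots> = integral {m..z} c * g m" by simp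
  also have "\<dots> \<le> integral {r..z} c * g m"
    using m r z c0 \<open>g m > 0\<close> by (intro mult_right_mono integral_subset_le ci) auto
  also have "\<dots> < g m" using rc \<open>g m > 0\<close> by simp
  finally show False by simp
qed

lemma limit_points_at_one_sided_Lipschitz:
  fixes f :: "'a::euclidean_space \<Rightarrow> 'a"
  assumes f: "\<And>x y. (f x - f y) \<bullet> (x - y) \<ge> - C * (norm (x - y))\<^sup>2"
    and "z \<in> limit_points_at f x" "w \<in> limit_points_at f y"
  shows "(z - w) \<bullet> (x - y) \<ge> - C * (norm (x - y))\<^sup>2"
proof -
  obtain p q :: "nat \<Rightarrow> 'a" where p: "filterlim p (at x) sequentially" "(\<lambda>n. f (p n)) \<longlonglongrightarrow> z"
    and q: "filterlim q (at y) sequentially" "(\<lambda>n. f (q n)) \<longlonglongrightarrow> w"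
    using assms(2,3) by (auto simp: limit_points_at_def)
  have pq: "p \<longlonglongrightarrow> x" "q \<longlonglongrightarrow> y" using p(1) q(1) by (auto simp: filterlim_at)
  show ?thesis
  proof (rule LIMSEQ_le)
    show "(\<lambda>n. - C * (norm (p n - q n))\<^sup>2) \<longlonglongrightarrow> - C * (norm (x - y))\<^sup>2"
      by (intro tendsto_intros pq)
    show "(\<lambda>n. (f (p n) - f (q n)) \<bullet> (p n - q n)) \<longlonglongrightarrow> (z - w) \<bullet> (x - y)"
      by (intro tendsto_intros pq p q)
  qed (use f in auto)
qed

text \<open>For fixed \<open>w\<close> the inequality says that \<open>z\<close> lies in a half-space, which is convex and so contains the
  hull once it contains the limit points; then the roles of \<open>z\<close> and \<open>w\<close> are exchanged.\<close>

lemma filippov_hull_one_sided_Lipschitz: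
  fixes b :: "real \<Rightarrow> 'a::euclidean_space \<Rightarrow> 'a"
  assumes b: "\<And>x y. (b t x - b t y) \<bullet> (x - y) \<ge> - C * (norm (x - y))\<^sup>2"
    and z: "z \<in> filippov_hull b t x" and w: "w \<in> filippov_hull b t y"
  shows "(z - w) \<bullet> (x - y) \<ge> - C * (norm (x - y))\<^sup>2"
proof -
  let ?c = "- C * (norm (x - y))\<^sup>2"
  have 1: "(z - w) \<bullet> (x - y) \<ge> ?c" if "w \<in> limit_points_at (b t) y" for w
  proof -
    have "convex hull limit_points_at (b t) x \<subseteq> {z. (x - y) \<bullet> z \<ge> ?c + (x - y) \<bullet> w}"
      using limit_points_at_one_sided_Lipschitz[OF b _ that, where x = x]
      by (intro hull_minimal convex_halfspace_ge) (auto simp: inner_diff_left inner_commute algebra_simps)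
    then show ?thesis using z by (auto simp: filippov_hull_def inner_diff_left inner_commute algebra_simps)
  qed
  have "convex hull limit_points_at (b t) y \<subseteq> {w. (x - y) \<bullet> w \<le> (x - y) \<bullet> z - ?c}"
    using 1 by (intro hull_minimal convex_halfspace_le) (auto simp: inner_diff_left inner_commute algebra_simps)
  then show ?thesis using w by (auto simp: filippov_hull_def inner_diff_left inner_commute algebra_simps)
qed

lemma filippov_solution_subset:
  assumes X: "filippov_solution b u v X" and sub: "{u'..v'} \<subseteq> {u..v}"
  shows "filippov_solution b u' v' X"
proof -
  have "AE t in lebesgue. t \<in> {u..v} \<longrightarrow>
      (\<exists>w \<in> filippov_hull b t (X t). (X has_vector_derivative w) (at t within {u..v}))"
    using X by (simp add: filippov_solution_def AE_restrict_space_iff)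
  then have "AE t in lebesgue. t \<in> {u'..v'} \<longrightarrow>
      (\<exists>w \<in> filippov_hull b t (X t). (X has_vector_derivative w) (at t within {u'..v'}))"
    by (rule eventually_mono) (use sub in \<open>blast intro: has_vector_derivative_within_subset\<close>)
  then show ?thesis
    using X abs_continuous_curve_subset[OF _ sub, of X] by (simp add: filippov_solution_def AE_restrict_space_iff)
qed

lemma filippov_solution_cong:
  assumes X: "filippov_solution b u v X" and eq: "\<And>t. t \<in> {u..v} \<Longrightarrow> X t = Y t"
  shows "filippov_solution b u v Y"
proof -
  have "AE t in lebesgue. t \<in> {u..v} \<longrightarrow>
      (\<exists>w \<in> filippov_hull b t (X t). (X has_vector_derivative w) (at t within {u..v}))"
    using X by (simp add: filippov_solution_def AE_restrict_space_iff)
  then have "AE t in lebesgue. t \<in> {u..v} \<longrightarrow>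
      (\<exists>w \<in> filippov_hull b t (Y t). (Y has_vector_derivative w) (at t within {u..v}))"
    by (rule eventually_mono) (metis eq has_vector_derivative_transform)
  then show ?thesis
    using X abs_continuous_curve_cong[of u v X Y] eq
    by (simp add: filippov_solution_def AE_restrict_space_iff)
qed

lemma filippov_solution_null_exception:
  assumes "filippov_solution b u v X"
  obtains N where "negligible N"
    "\<And>t. t \<in> {u..v} - N \<Longrightarrow> \<exists>w \<in> filippov_hull b t (X t). (X has_vector_derivative w) (at t within {u..v})"
proof -
  have "AE t in lebesgue. t \<in> {u..v} \<longrightarrow>
      (\<exists>w \<in> filippov_hull b t (X t). (X has_vector_derivative w) (at t within {u..v}))"
    using assms by (simp add: filippov_solution_def AE_restrict_space_iff)
  then obtain N where "N \<in> null_sets lebesgue" "{t. \<not> (t \<in> {u..v} \<longrightarrow>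
      (\<exists>w \<in> filippov_hull b t (X t). (X has_vector_derivative w) (at t within {u..v})))} \<subseteq> N"
    by (auto simp: eventually_ae_filter)
  then show ?thesis by (intro that[of N]) (auto simp: negligible_iff_null_sets)
qed

text \<open>Gronwall's inequality for \<open>g = |X - Y|\<^sup>2\<close>, whose derivative is \<open>2 (w - z) \<bullet> (X - Y)\<close> with velocities \<open>w\<close>
  and \<open>z\<close> from the hulls at \<open>X t\<close> and \<open>Y t\<close>.  Forward in time the bound has the wrong sign: solutions
  may branch.\<close>

theorem filippov_solution_backward_unique:
  fixes b :: "real \<Rightarrow> 'a::euclidean_space \<Rightarrow> 'a"
  assumes C: "C absolutely_integrable_on {u..v}" and C0: "\<And>t. t \<in> {u..v} \<Longrightarrow> C t \<ge> 0"
    and b: "\<And>t x y. t \<in> {u..v} \<Longrightarrow> (b t x - b t y) \<bullet> (x - y) \<ge> - C t * (norm (x - y))\<^sup>2"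
    and X: "filippov_solution b u v X" and Y: "filippov_solution b u v Y"
    and "X v = Y v" and r: "r \<in> {u..v}"
  shows "X r = Y r"
proof -
  define g where "g t = (norm (X t - Y t))\<^sup>2" for t
  have sub: "{r..v} \<subseteq> {u..v}" using r by auto
  have X': "filippov_solution b r v X" and Y': "filippov_solution b r v Y"
    by (rule filippov_solution_subset[OF X sub] filippov_solution_subset[OF Y sub])+
  obtain N where N: "negligible N" "\<And>t. t \<in> {r..v} - N \<Longrightarrow>
      \<exists>w \<in> filippov_hull b t (X t). (X has_vector_derivative w) (at t within {r..v})"
    using filippov_solution_null_exception[OF X'] by metis
  obtain M where M: "negligible M" "\<And>t. t \<in> {r..v} - M \<Longrightarrow>
      \<exists>w \<in> filippov_hull b t (Y t). (Y has_vector_derivative w) (at t within {r..v})"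
    using filippov_solution_null_exception[OF Y'] by metis
  have "g r = 0"
  proof (rule gronwall_backward_zero[where g = g and a = r and c = "\<lambda>t. 2 * C t" and N = "N \<union> M" and b = v])
    show "abs_continuous_curve r v g"
      unfolding g_def using X' Y'
      by (intro abs_continuous_curve_norm_square abs_continuous_curve_diff) (auto simp: filippov_solution_def)
    have "C absolutely_integrable_on {r..v}"
      by (rule absolutely_integrable_on_subinterval[OF C sub])
    then show "(\<lambda>t. 2 * C t) absolutely_integrable_on {r..v}"
      by (intro set_integrable_mult_right) auto
    fix t assume t: "t \<in> {r..v} - (N \<union> M)"
    obtain w z where w: "w \<in> filippov_hull b t (X t)" "(X has_vector_derivative w) (at t within {r..v})"
      and z: "z \<in> filippov_hull b t (Y t)" "(Y has_vector_derivative z) (at t within {r..v})"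
      using N(2) M(2) t by blast
    have D: "((\<lambda>t. X t - Y t) has_vector_derivative w - z) (at t within {r..v})"
      by (intro has_vector_derivative_diff w z)
    have "(g has_vector_derivative 2 * ((w - z) \<bullet> (X t - Y t))) (at t within {r..v})"
      using bounded_bilinear.has_vector_derivative[OF bounded_bilinear_inner D D]
      unfolding g_def by (simp add: power2_norm_eq_inner inner_commute)
    moreover have "(w - z) \<bullet> (X t - Y t) \<ge> - C t * g t"
      unfolding g_def by (rule filippov_hull_one_sided_Lipschitz[OF b w(1) z(1)]) (use t sub in auto)
    ultimately show "\<exists>d. (g has_vector_derivative d) (at t within {r..v}) \<and> - (2 * C t * g t) \<le> d"
      by (intro exI conjI) (assumption, simp)
  qed (use r N(1) M(1) C0 assms(6) in \<open>auto simp: g_def\<close>)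
  then show ?thesis by (simp add: g_def)
qed

section \<open>The forward flow\<close>

lemma continuous_eq_on_rationals:
  fixes f g :: "real \<Rightarrow> 'a::real_normed_vector"
  assumes f: "continuous_on {s..T} f" and g: "continuous_on {s..T} g"
    and eq: "\<And>t. t \<in> insert T \<rat> \<inter> {s..T} \<Longrightarrow> f t = g t" and "t \<in> {s..T}"
  shows "f t = g t"
proof (cases "s < T")
  case True
  have "closure ({s<..<T} \<inter> \<rat>) = {s..T}"
    using True by (subst closure_open_Int_superset) (auto simp: Rats_closure_real)
  moreover have "continuous_on {s..T} (\<lambda>t. f t - g t)" by (intro continuous_on_diff f g)
  ultimately have "f t - g t = 0"
    using continuous_constant_on_closure[of "{s<..<T} \<inter> \<rat>" "\<lambda>t. f t - g t" 0 t] eq \<open>t \<in> {s..T}\<close>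
    by auto
  then show ?thesis by simp
next
  case False
  then show ?thesis using assms(3,4) by auto
qed

text \<open>The backward flow retraces every solution, also one that is only known on \<open>[s, t]\<close>.  Applied to the
  trajectories of the flow itself this is its semigroup property.\<close>

lemma backward_flow_follows_solution:
  fixes b :: "real \<Rightarrow> 'a::euclidean_space \<Rightarrow> 'a"
  assumes C: "C absolutely_integrable_on {0..T}" and C0: "\<And>t. t \<in> {0..T} \<Longrightarrow> C t \<ge> 0"
    and b: "\<And>t x y. t \<in> {0..T} \<Longrightarrow> (b t x - b t y) \<bullet> (x - y) \<ge> - C t * (norm (x - y))\<^sup>2"
    and \<phi>: "backward_flow b T \<phi>"
    and X: "filippov_solution b s t X" and st: "0 \<le> s" "t \<le> T" and r: "r \<in> {s..t}"
  shows "\<phi> r t (X t) = X r"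
proof -
  have t: "t \<in> {0..T}" using st r by auto
  have sub: "{s..t} \<subseteq> {0..T}" "{s..t} \<subseteq> {0..t}" using st by auto
  have sol: "filippov_solution b 0 t (\<lambda>r. \<phi> r t (X t))" and at_t: "\<phi> t t (X t) = X t"
    using \<phi> t by (auto simp: backward_flow_def)
  show ?thesis
  proof (rule filippov_solution_backward_unique[where X = "\<lambda>r. \<phi> r t (X t)"])
    show "C absolutely_integrable_on {s..t}" by (rule absolutely_integrable_on_subinterval[OF C sub(1)])
    show "filippov_solution b s t (\<lambda>r. \<phi> r t (X t))" by (rule filippov_solution_subset[OF sol sub(2)])
  qed (use C0 b X at_t r sub(1) in auto)
qed

theorem theorem4p12:
  fixes T :: real
    and b :: "real \<Rightarrow> 'a::euclidean_space \<Rightarrow> 'a"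
    and C\<^sub>0 C\<^sub>1 :: "real \<Rightarrow> real"
    and \<phi> :: "real \<Rightarrow> real \<Rightarrow> 'a \<Rightarrow> 'a"
  assumes "T > 0"
    and "(\<lambda>(t, x). b t x) \<in> borel_measurable (lebesgue_on ({0..T} \<times> UNIV))"
    and "C\<^sub>0 absolutely_integrable_on {0..T}" and "\<And>t. t \<in> {0..T} \<Longrightarrow> C\<^sub>0 t \<ge> 0"
    and "C\<^sub>1 absolutely_integrable_on {0..T}" and "\<And>t. t \<in> {0..T} \<Longrightarrow> C\<^sub>1 t \<ge> 0"
    and "\<And>t x. t \<in> {0..T} \<Longrightarrow> norm (b t x) \<le> C\<^sub>0 t * (1 + norm x)"
    and "\<And>t x y. t \<in> {0..T} \<Longrightarrow> (b t x - b t y) \<bullet> (x - y) \<ge> - C\<^sub>1 t * (norm (x - y))\<^sup>2"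
    and "forward_flow b T \<phi>"
  shows "\<forall>s\<in>{0..T}. AE x in lebesgue.
           filippov_solution b s T (\<lambda>t. \<phi> t s x) \<and> \<phi> s s x = x \<and>
           (\<forall>X. filippov_solution b s T X \<and> X s = x \<longrightarrow> (\<forall>t\<in>{s..T}. X t = \<phi> t s x))"
proof
  fix s assume s: "s \<in> {0..T}"
  have bwd: "backward_flow b T \<phi>"
    and inv: "\<And>t. t \<in> {s..T} \<Longrightarrow> AE x in lebesgue. \<phi> s t -` {x} = {\<phi> t s x}"
    and ac: "AE x in lebesgue. abs_continuous_curve s T (\<lambda>t. \<phi> t s x)"
    using \<open>forward_flow b T \<phi>\<close> s by (auto simp: forward_flow_def)
  note follows = backward_flow_follows_solution[OF assms(5,6,8) bwd]
  (* The exceptional null set of the inverse depends on t, so only countably many t are admitted.  The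
     endpoint T is needed for existence and may be irrational. *)
  define Q where "Q = insert T \<rat> \<inter> {s..T}"
  have "countable Q" by (auto simp: Q_def countable_rat)
  then have "AE x in lebesgue. \<forall>t\<in>Q. \<phi> s t -` {x} = {\<phi> t s x}"
    by (rule AE_ball_countable'[rotated]) (auto simp: Q_def intro: inv)
  with ac show "AE x in lebesgue. filippov_solution b s T (\<lambda>t. \<phi> t s x) \<and> \<phi> s s x = x \<and>
      (\<forall>X. filippov_solution b s T X \<and> X s = x \<longrightarrow> (\<forall>t\<in>{s..T}. X t = \<phi> t s x))"
  proof eventually_elim
    case (elim x)
    (* Every solution that starts at x sits in the fibres of the backward flow over x, which are singletons on Q. *)
    have unique: "X t = \<phi> t s x" if X: "filippov_solution b s T X" "X s = x" and "t \<in> {s..T}" for X t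
    proof (rule continuous_eq_on_rationals[OF _ _ _ \<open>t \<in> {s..T}\<close>, where f = X])
      show "continuous_on {s..T} X" "continuous_on {s..T} (\<lambda>t. \<phi> t s x)"
        using X(1) elim(1) by (auto simp: filippov_solution_def intro: abs_continuous_curve_imp_continuous_on)
      fix q assume q: "q \<in> insert T \<rat> \<inter> {s..T}"
      have "filippov_solution b s q X" by (rule filippov_solution_subset[OF X(1)]) (use q in auto)
      then have "\<phi> s q (X q) = x" using follows[of s q X s] X(2) s q by auto
      moreover have "\<phi> s q -` {x} = {\<phi> q s x}" using elim(2) q unfolding Q_def by blast
      ultimately show "X q = \<phi> q s x" by blast
    qed
    (* Existence: run the backward flow from the point that the forward flow reaches at time T. *)
    define Y where "Y = (\<lambda>t. \<phi> t T (\<phi> T s x))"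
    have "filippov_solution b 0 T Y" using bwd s by (auto simp: backward_flow_def Y_def)
    then have Y: "filippov_solution b s T Y" by (rule filippov_solution_subset) (use s in auto)
    have "T \<in> Q" using s by (auto simp: Q_def)
    with elim(2) have "\<phi> s T -` {x} = {\<phi> T s x}" by (rule bspec)
    then have "\<phi> T s x \<in> \<phi> s T -` {x}" by simp
    then have "Y s = x" by (simp add: Y_def)
    have "filippov_solution b s T (\<lambda>t. \<phi> t s x)"
      by (rule filippov_solution_cong[OF Y unique[OF Y \<open>Y s = x\<close>]])
    moreover have "\<phi> s s x = x" using bwd s by (auto simp: backward_flow_def)
    moreover have "\<forall>X. filippov_solution b s T X \<and> X s = x \<longrightarrow> (\<forall>t\<in>{s..T}. X t = \<phi> t s x)"
      by (intro allI impI ballI) (erule conjE, rule unique)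
    ultimately show ?case by (intro conjI)
  qed
qed

end
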